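(* $M_n$ is a noncommutative monoid under matrix multiplication with identity $\mathbf{1}=\langle 0,1,n\rangle$. For any two nonzero elements $\langle d,k,m\rangle$, $\langle d',k',m'\rangle$ of $M_n$, set $$d''=d+d',\qquad k''=\max(k,k'-d),\qquad m''=\min(m,m'-d).$$ Then $\langle d,k,m\rangle\langle d',k',m'\rangle=\langle d'',k'',m''\rangle$ if $k''\le m''$, and $\langle d,k,m\rangle\langle d',k',m'\rangle=\mathbf{0}$ if $k''>m''$. Moreover, irrespective of whether $k''\le m''$ or not, $$1-\min(0,d'')\le k''\quad\text{and}\quad m''\le n-\max(0,d'').$$
   Context: Fix an integer $n\ge 2$. For integers $d,k,m$ with $1-\min(0,d)\le k\le m\le n-\max(0,d)$, let $\langle d,k,m\rangle$ denote the $n\times n$ matrix with entries $x_{ij}$ ($i,j\in\{1,\dots,n\}$) equal to $1$ if $k\le i\le m$ and $j-i=d$, and $0$ otherwise (its ones lie on the $d$-th diagonal, $d=0$ the main diagonal, $d>0$ above, $d<0$ below, in rows $k$ to $m$, forming an uninterrupted block of $m-k+1$ ones). Distinct admissible triples give distinct matrices. Let $\mathbf{0}$ be the $n\times n$ zero matrix and $M_n=\{\mathbf{0}\}\cup\{\langle d,k,m\rangle: d\in\mathbb{Z},\ k,m\in\mathbb{N},\ 1-\min(0,d)\le k\le m\le n-\max(0,d)\}$, with matrix multiplication. *)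

theory Defs
  imports "Jordan_Normal_Form.Matrix" "HOL-Algebra.Group"
begin

definition admissible :: "nat \<Rightarrow> int \<Rightarrow> int \<Rightarrow> int \<Rightarrow> bool" where
  "admissible n d k m \<longleftrightarrow> 1 - min 0 d \<le> k \<and> k \<le> m \<and> m \<le> int n - max 0 d"

text \<open>
  Library matrices are indexed from 0; the shift by one below restores the row and column
  numbers \<open>i, j \<in> {1..n}\<close>. The entries live in an arbitrary semiring with \<open>0 \<noteq> 1\<close>.
\<close>

definition diag_block :: "nat \<Rightarrow> int \<Rightarrow> int \<Rightarrow> int \<Rightarrow> 'a::semiring_1 mat" where
  "diag_block n d k m = mat n n (\<lambda>(r, c).
     let i = int r + 1; j = int c + 1
     in if k \<le> i \<and> i \<le> m \<and> j - i = d then 1 else 0)"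

text \<open>
  Admissibility forces \<open>1 \<le> k \<le> m\<close>, so letting \<open>k\<close> and \<open>m\<close> range over the integers gives
  the same set as letting them range over the naturals.
\<close>

definition block_matrices :: "nat \<Rightarrow> 'a::semiring_1 mat set" where
  "block_matrices n = {0\<^sub>m n n} \<union> {diag_block n d k m | d k m. admissible n d k m}"

definition block_monoid :: "nat \<Rightarrow> 'a::semiring_1 mat monoid" where
  "block_monoid n = \<lparr>carrier = block_matrices n, mult = (*), one = diag_block n 0 1 (int n)\<rparr>"

end

theory Submission
  imports Defs
begin

text \<open>Each row of a block matrix contains at most one 1: row i of <d,k,m> is the unit row
  vector at i + d if k \<le> i \<le> m, and zero otherwise. So row i of a product <d,k,m><d',k',m'>
  is row i + d of the second factor for i in [k, m], and zero otherwise; it has its 1 in column i +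
  d + d' exactly when also k' \<le> i + d \<le> m'. Intersecting the two ranges for i gives the max
  and the min (\<open>diag_block_mult\<close>), and an empty intersection gives the zero matrix
  (\<open>diag_block_eq_zero\<close>). The bounds in \<open>admissible_mult_bounds\<close> then
  yield closure; associativity and the unit laws come from the full matrix semiring.\<close>

lemma diag_block_carrier [simp]: "diag_block n d k m \<in> carrier_mat n n"
  by (simp add: diag_block_def)

lemma index_diag_block:
  assumes "r < n" "c < n"
  shows "diag_block n d k m $$ (r, c) =
    (if k \<le> int r + 1 \<and> int r + 1 \<le> m \<and> int c = int r + d then 1 else 0)"
  using assms by (auto simp: diag_block_def Let_def)

text \<open>Since \<open>diag_block\<close> is defined for all integers, an empty row range makes
  sense, and one product formula serves both cases of the theorem.\<close>

lemma diag_block_eq_zero: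
  assumes "k > m"
  shows "diag_block n d k m = 0\<^sub>m n n"
proof (rule eq_matI)
  fix r c
  assume "r < dim_row (0\<^sub>m n n :: 'a mat)" "c < dim_col (0\<^sub>m n n :: 'a mat)"
  then show "(diag_block n d k m :: 'a mat) $$ (r, c) = 0\<^sub>m n n $$ (r, c)"
    using assms by (simp add: index_diag_block)
qed (simp_all add: diag_block_def)

lemma diag_block_eq_one: "diag_block n 0 1 (int n) = 1\<^sub>m n"
proof (rule eq_matI)
  fix r c
  assume "r < dim_row (1\<^sub>m n :: 'a mat)" "c < dim_col (1\<^sub>m n :: 'a mat)"
  then show "(diag_block n 0 1 (int n) :: 'a mat) $$ (r, c) = 1\<^sub>m n $$ (r, c)"
    by (simp add: index_diag_block)
qed (simp_all add: diag_block_def)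

lemma diag_block_mult:
  assumes "admissible n d k m"
  shows "(diag_block n d k m * diag_block n d' k' m' :: 'a::semiring_1 mat) =
    diag_block n (d + d') (max k (k' - d)) (min m (m' - d))" (is "?A * ?B = ?C")
proof (rule eq_matI)
  fix r c
  assume "r < dim_row ?C" "c < dim_col ?C"
  then have rc: "r < n" "c < n"
    by (simp_all add: diag_block_def)
  have "(?A * ?B) $$ (r, c) = (\<Sum>s<n. ?A $$ (r, s) * ?B $$ (s, c))"
    using rc by (simp add: diag_block_def scalar_prod_def lessThan_atLeast0)
  also have "\<dots> = ?C $$ (r, c)"
  proof (cases "k \<le> int r + 1 \<and> int r + 1 \<le> m")
    case True
    \<comment> \<open>The 0-based column of the only 1 in row \<open>r\<close> of \<open>?A\<close>.
      Admissibility of the first factor keeps it inside the matrix, so the sum over \<open>s\<close>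
      meets it.\<close>
    define t where "t = nat (int r + d)"
    have "0 \<le> int r + d" "int r + d < int n"
      using True assms unfolding admissible_def by linarith+
    then have t: "int t = int r + d" "t < n"
      unfolding t_def by linarith+
    have "(\<Sum>s<n. ?A $$ (r, s) * ?B $$ (s, c)) = (\<Sum>s<n. if s = t then ?B $$ (s, c) else 0)"
      using rc True by (intro sum.cong) (auto simp: index_diag_block simp flip: t(1))
    also have "\<dots> = ?B $$ (t, c)"
      using t by simp
    also have "\<dots> = ?C $$ (r, c)"
    proof -
      \<comment> \<open>Shifting rows by \<open>d\<close> turns the range of \<open>?B\<close> into
        a condition on \<open>r\<close>; together with \<open>True\<close> it is the range of
        \<open>?C\<close>.\<close>
      have "k' \<le> int t + 1 \<and> int t + 1 \<le> m' \<and> int c = int t + d' \<longleftrightarrow>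
          k' - d \<le> int r + 1 \<and> int r + 1 \<le> m' - d \<and> int c = int r + (d + d')"
        using t(1) by linarith
      then show ?thesis
        using True by (simp only: index_diag_block rc t(2) max.bounded_iff min.bounded_iff) simp
    qed
    finally show ?thesis .
  next
    case False
    \<comment> \<open>The row range of \<open>?C\<close> lies within [k, m], so row \<open>r\<close>
      vanishes in \<open>?C\<close> as well as in \<open>?A\<close>.\<close>
    then have "\<forall>s<n. ?A $$ (r, s) = 0" "?C $$ (r, c) = 0"
      using rc by (auto simp: index_diag_block)
    then show ?thesis
      by simp
  qed
  finally show "(?A * ?B) $$ (r, c) = ?C $$ (r, c)" .
qed (simp_all add: diag_block_def)

text \<open>From k \<ge> 1 and k' - d \<ge> 1 - d' - d, the maximum is at least both 1 and 1 - (d +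
  d'). Dually, m \<le> n and m' - d \<le> n - d' - d.\<close>

lemma admissible_mult_bounds:
  assumes "admissible n d k m" "admissible n d' k' m'"
  shows "1 - min 0 (d + d') \<le> max k (k' - d)"
    and "min m (m' - d) \<le> int n - max 0 (d + d')"
  using assms unfolding admissible_def by linarith+

lemma block_matrices_cases:
  assumes "A \<in> block_matrices n"
  obtains "A = 0\<^sub>m n n" | d k m where "admissible n d k m" "A = diag_block n d k m"
  using assms unfolding block_matrices_def by blast

lemma block_matrices_subset: "block_matrices n \<subseteq> carrier_mat n n"
  by (auto elim: block_matrices_cases)

lemma zero_in_block_matrices: "0\<^sub>m n n \<in> block_matrices n"
  by (simp add: block_matrices_def)

lemma diag_block_in_block_matrices:
  "admissible n d k m \<Longrightarrow> diag_block n d k m \<in> block_matrices n"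
  unfolding block_matrices_def by blast

text \<open>The bounds hold even for an empty range, so a product of two blocks is admissible as
  soon as its range is nonempty, and zero otherwise.\<close>

lemma block_matrices_mult_closed:
  assumes A: "A \<in> block_matrices n" and B: "B \<in> block_matrices n"
  shows "A * B \<in> block_matrices n"
  using A
proof (cases rule: block_matrices_cases)
  case 1
  then show ?thesis
    using subsetD[OF block_matrices_subset B] by (simp add: zero_in_block_matrices)
next
  case A: (2 d k m)
  show ?thesis
    using B
  proof (cases rule: block_matrices_cases)
    case 1
    then show ?thesis
      using A by (simp add: zero_in_block_matrices right_mult_zero_mat[OF diag_block_carrier])
  next
    case B: (2 d' k' m')
    let ?k = "max k (k' - d)" and ?m = "min m (m' - d)"
    have AB: "A * B = diag_block n (d + d') ?k ?m"
      using A B by (simp add: diag_block_mult)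
    show ?thesis
    proof (cases "?k \<le> ?m")
      case True
      then have "admissible n (d + d') ?k ?m"
        using admissible_mult_bounds[OF A(1) B(1)] by (simp add: admissible_def)
      then show ?thesis
        unfolding AB by (rule diag_block_in_block_matrices)
    next
      case False
      then have "A * B = 0\<^sub>m n n"
        unfolding AB by (simp only: not_le diag_block_eq_zero)
      then show ?thesis
        by (simp add: zero_in_block_matrices)
    qed
  qed
qed

text \<open>Only closure is specific to blocks; the unit is the identity matrix, and n \<ge> 1 makes
  its row range nonempty.\<close>

lemma block_monoid_is_monoid:
  assumes "n \<ge> 1"
  shows "monoid (block_monoid n :: 'a::semiring_1 mat monoid)"
proof (rule monoidI)
  have "admissible n 0 1 (int n)"
    using assms by (simp add: admissible_def)
  then show "\<one>\<^bsub>block_monoid n\<^esub> \<in> carrier (block_monoid n :: 'a mat monoid)"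
    by (simp add: block_monoid_def diag_block_in_block_matrices)
next
  fix A B C :: "'a mat"
  assume "A \<in> carrier (block_monoid n)" "B \<in> carrier (block_monoid n)"
    "C \<in> carrier (block_monoid n)"
  then have "A \<in> carrier_mat n n" "B \<in> carrier_mat n n" "C \<in> carrier_mat n n"
    using block_matrices_subset by (auto simp: block_monoid_def)
  then show "A \<otimes>\<^bsub>block_monoid n\<^esub> B \<otimes>\<^bsub>block_monoid n\<^esub> C =
      A \<otimes>\<^bsub>block_monoid n\<^esub> (B \<otimes>\<^bsub>block_monoid n\<^esub> C)"
    by (simp add: block_monoid_def)
next
  fix A :: "'a mat"
  assume "A \<in> carrier (block_monoid n)"
  then have A: "A \<in> carrier_mat n n"
    using block_matrices_subset by (auto simp: block_monoid_def)
  show "\<one>\<^bsub>block_monoid n\<^esub> \<otimes>\<^bsub>block_monoid n\<^esub> A = A"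
    using A by (simp add: block_monoid_def diag_block_eq_one)
  show "A \<otimes>\<^bsub>block_monoid n\<^esub> \<one>\<^bsub>block_monoid n\<^esub> = A"
    using A by (simp add: block_monoid_def diag_block_eq_one)
qed (simp add: block_monoid_def block_matrices_mult_closed)

lemma block_matrices_noncommutative:
  assumes "n \<ge> 2"
  shows "\<exists>A \<in> block_matrices n. \<exists>B \<in> block_matrices n. A * B \<noteq> (B * A :: 'a::semiring_1 mat)"
proof (intro bexI)
  \<comment> \<open>The matrix units \<open>E\<^sub>1\<^sub>2\<close> and \<open>E\<^sub>2\<^sub>1\<close>.\<close>
  let ?A = "diag_block n 1 1 1 :: 'a mat" and ?B = "diag_block n (- 1) 2 2 :: 'a mat"
  have adm: "admissible n 1 1 1" "admissible n (- 1) 2 2"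
    using assms by (simp_all add: admissible_def)
  \<comment> \<open>The products are <0,1,1> and <0,2,2>, which differ in the top left
    entry.\<close>
  have "(?A * ?B) $$ (0, 0) = 1" "(?B * ?A) $$ (0, 0) = 0"
    using assms by (simp_all add: diag_block_mult adm index_diag_block)
  then show "?A * ?B \<noteq> ?B * ?A"
    by auto
  show "?A \<in> block_matrices n" "?B \<in> block_matrices n"
    using adm by (simp_all add: diag_block_in_block_matrices)
qed

theorem theorem3:
  fixes n :: nat
  assumes "n \<ge> 2"
  shows "monoid (block_monoid n :: 'a::semiring_1 mat monoid)
    \<and> (\<exists>A \<in> block_matrices n. \<exists>B \<in> block_matrices n. A * B \<noteq> (B * A :: 'a mat))
    \<and> (\<forall>d k m d' k' m'. admissible n d k m \<longrightarrow> admissible n d' k' m' \<longrightarrow>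
         (let d'' = d + d'; k'' = max k (k' - d); m'' = min m (m' - d) in
           (k'' \<le> m'' \<longrightarrow>
              diag_block n d k m * diag_block n d' k' m' = (diag_block n d'' k'' m'' :: 'a mat))
         \<and> (k'' > m'' \<longrightarrow>
              diag_block n d k m * diag_block n d' k' m' = (0\<^sub>m n n :: 'a mat))
         \<and> 1 - min 0 d'' \<le> k''
         \<and> m'' \<le> int n - max 0 d''))"
proof (intro conjI)
  show "monoid (block_monoid n :: 'a mat monoid)"
    using assms by (simp add: block_monoid_is_monoid)
  show "\<exists>A \<in> block_matrices n. \<exists>B \<in> block_matrices n. A * B \<noteq> (B * A :: 'a mat)"
    using assms by (rule block_matrices_noncommutative)
qed (simp add: Let_def diag_block_mult diag_block_eq_zero admissible_mult_bounds)

end
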